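(* Let $c\ge 1$ and $n\ge 1$ be integers and let $a\in\{1,\dots,c\}$ be a color. Then $$\left|\Pi_n^{eq}\wr C_c(1^a1^a)\right|=\sum_{i+2j\le n}\binom{n}{i,j}\sum_{p=j}^{n-i-j}\binom{n-i-j}{p}S(p,j)\,j!\,B(n-i-j-p)\,(c-1)^{n-i-j},$$ where the outer sum is over all pairs of nonnegative integers $(i,j)$ with $i+2j\le n$.
   Context: A set partition of $[n]=\{1,\dots,n\}$ is a collection of pairwise disjoint nonempty subsets (blocks) whose union is $[n]$. $\Pi_n\wr C_c$ denotes the set of colored set partitions of $[n]$ with $c$ colors: pairs consisting of a set partition of $[n]$ and an assignment of a color in $\{1,\dots,c\}$ to each element of $[n]$. A colored partition eq-contains the colored pattern $1^a1^a$ if some block contains two distinct elements both of color $a$; otherwise it eq-avoids it. $\Pi_n^{eq}\wr C_c(1^a1^a)$ is the set of elements of $\Pi_n\wr C_c$ that eq-avoid $1^a1^a$. $B(m)$ is the $m$-th Bell number ($B(0)=1$), $S(p,j)$ is the Stirling number of the second kind (with $S(0,0)=1$, $S(p,0)=0$ for $p>0$), and $\binom{n}{i,j}=\frac{n!}{i!\,j!\,(n-i-j)!}$. *)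

theory Defs
  imports "HOL-Library.Disjoint_Sets" "HOL-Library.FuncSet" "HOL-Combinatorics.Stirling"
begin

definition set_partitions :: "nat \<Rightarrow> nat set set set" where
  "set_partitions n = {P. partition_on {1..n} P}"

(* Colorings are extensional (PiE), so each coloring of {1..n} is counted exactly once. *)
definition colored_partitions :: "nat \<Rightarrow> nat \<Rightarrow> (nat set set \<times> (nat \<Rightarrow> nat)) set" where
  "colored_partitions n c = set_partitions n \<times> ({1..n} \<rightarrow>\<^sub>E {1..c})"

(* Containment of the pattern 1^a 1^a: two elements in one block, both of color a. *)
definition eq_contains_11 :: "nat \<Rightarrow> nat set set \<times> (nat \<Rightarrow> nat) \<Rightarrow> bool" where
  "eq_contains_11 a \<pi> \<longleftrightarrow>
     (\<exists>X \<in> fst \<pi>. \<exists>x \<in> X. \<exists>y \<in> X. x \<noteq> y \<and> snd \<pi> x = a \<and> snd \<pi> y = a)"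

definition eq_avoiders_11 :: "nat \<Rightarrow> nat \<Rightarrow> nat \<Rightarrow> (nat set set \<times> (nat \<Rightarrow> nat)) set" where
  "eq_avoiders_11 n c a = {\<pi> \<in> colored_partitions n c. \<not> eq_contains_11 a \<pi>}"

definition Bell :: "nat \<Rightarrow> nat" where
  "Bell m = card (set_partitions m)"

(* For i + j <= n the division is exact; other arguments are not meaningful. *)
definition trinomial :: "nat \<Rightarrow> nat \<Rightarrow> nat \<Rightarrow> nat" where
  "trinomial n i j = fact n div (fact i * fact j * fact (n - i - j))"

end

theory Submission
  imports Defs
begin

text \<open>Let \<open>A\<close> be the set of elements of color \<open>a\<close>, with \<open>k\<close> elements, and let \<open>m = n - k\<close>. The
  other elements can be colored in \<open>(c - 1)\<^sup>m\<close> ways, and avoidance says that every block contains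
  at most one element of \<open>A\<close>. The partitions with this property are built by choosing \<open>p\<close> elements
  outside \<open>A\<close>, attaching each of them to one of the \<open>k\<close> elements of \<open>A\<close>, and partitioning the
  remaining \<open>m - p\<close> elements freely. Expanding \<open>k\<^sup>p\<close> in falling factorials of \<open>k\<close> introduces the
  Stirling numbers; the index \<open>j\<close> is then the number of elements of \<open>A\<close> to which something is
  attached, and \<open>i = k - j\<close>.\<close>

section \<open>Powers in terms of falling factorials; sums over subsets\<close>

text \<open>Sorting the maps from a \<open>p\<close>-set to a \<open>k\<close>-set by their image of
  size \<open>j\<close> explains the identity: there are \<open>fact j * Stirling p j\<close>
  surjections onto each image. The proof itself is by the recurrence of \<open>Stirling\<close> in
  \<open>p\<close>. The bound \<open>k\<close>, rather than \<open>p\<close>, keeps the range of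
  \<open>j\<close> independent of \<open>p\<close>, so that the sums can be swapped later.\<close>

lemma power_eq_sum_Stirling:
  fixes k p :: nat
  shows "k ^ p = (\<Sum>j\<le>k. (k choose j) * fact j * Stirling p j)"
proof (induction p)
  case 0
  have "(\<Sum>j\<le>k. (k choose j) * fact j * Stirling 0 j) = (\<Sum>j\<in>{0}. (k choose j) * fact j * Stirling 0 j)"
    by (rule sum.mono_neutral_right) (auto simp: gr0_conv_Suc)
  then show ?case by simp
next
  case (Suc p)
  let ?f = "\<lambda>j. (k choose j) * fact j"
  \<comment> \<open>\<open>?f j\<close> is the falling factorial of \<open>k\<close> of length
    \<open>j\<close>. The truncated \<open>k - j\<close> is harmless: for \<open>j \<ge> k\<close>
    both sides are 0.\<close>
  have falling: "?f (Suc j) = (k - j) * ?f j" for j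
  proof -
    have "Suc j * (k choose Suc j) = (k - j) * (k choose j)"
      by (metis binomial_absorb_comp binomial_absorption mult.commute)
    then have "fact j * (Suc j * (k choose Suc j)) = fact j * ((k - j) * (k choose j))"
      by simp
    then show ?thesis
      by (simp only: fact_Suc of_nat_id mult_ac)
  qed
  \<comment> \<open>The \<open>case\<close> expression is the term \<open>Stirling p (j - 1)\<close>
    of the recurrence, with the value 0 at \<open>j = 0\<close>. Extending the sum to
    \<open>Suc k\<close> adds only a zero term, and the index shift then leads back to the range up
    to \<open>k\<close>.\<close>
  have shift: "(\<Sum>j\<le>k. ?f j * (case j of 0 \<Rightarrow> 0 | Suc i \<Rightarrow> Stirling p i))
      = (\<Sum>j\<le>k. (k - j) * ?f j * Stirling p j)"
  proof -
    have "(\<Sum>j\<le>k. ?f j * (case j of 0 \<Rightarrow> 0 | Suc i \<Rightarrow> Stirling p i))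
        = (\<Sum>j\<le>Suc k. ?f j * (case j of 0 \<Rightarrow> 0 | Suc i \<Rightarrow> Stirling p i))"
      by simp
    also have "\<dots> = (\<Sum>j\<le>k. ?f (Suc j) * Stirling p j)"
      by (subst sum.atMost_Suc_shift) simp
    finally show ?thesis
      by (simp only: falling)
  qed
  have "(\<Sum>j\<le>k. ?f j * Stirling (Suc p) j)
      = (\<Sum>j\<le>k. ?f j * (j * Stirling p j) + ?f j * (case j of 0 \<Rightarrow> 0 | Suc i \<Rightarrow> Stirling p i))"
    by (rule sum.cong) (auto simp: algebra_simps split: nat.split)
  also have "\<dots> = (\<Sum>j\<le>k. ?f j * (j * Stirling p j) + (k - j) * ?f j * Stirling p j)"
    by (simp only: sum.distrib shift)
  \<comment> \<open>The weights \<open>j\<close> and \<open>k - j\<close> add up to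
    \<open>k\<close>, because \<open>j \<le> k\<close>.\<close>
  also have "\<dots> = (\<Sum>j\<le>k. k * (?f j * Stirling p j))"
  proof (rule sum.cong)
    fix j assume "j \<in> {..k}"
    then have "k * (?f j * Stirling p j) = (j + (k - j)) * (?f j * Stirling p j)" by simp
    also have "\<dots> = ?f j * (j * Stirling p j) + (k - j) * ?f j * Stirling p j"
      unfolding distrib_right by (simp only: mult_ac)
    finally show "?f j * (j * Stirling p j) + (k - j) * ?f j * Stirling p j = k * (?f j * Stirling p j)" ..
  qed simp
  also have "\<dots> = k ^ Suc p"
    by (simp add: Suc.IH sum_distrib_left)
  finally show ?case by simp
qed

lemma sum_Pow_card:
  fixes h :: "nat \<Rightarrow> nat"
  assumes "finite S"
  shows "(\<Sum>A\<in>Pow S. h (card A)) = (\<Sum>k\<le>card S. (card S choose k) * h k)"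
proof -
  have "(\<Sum>A\<in>Pow S. h (card A)) = (\<Sum>k\<le>card S. \<Sum>A\<in>{A \<in> Pow S. card A = k}. h (card A))"
    using assms by (intro sum.group [symmetric]) (auto intro: card_mono)
  also have "\<dots> = (\<Sum>k\<le>card S. (card S choose k) * h k)"
    by (rule sum.cong) (simp_all add: n_subsets [OF assms] flip: Pow_def)
  finally show ?thesis .
qed

section \<open>Counting set partitions\<close>

text \<open>\<open>Bell\<close> only speaks of the ground sets \<open>{1..m}\<close>; a bijection of
  ground sets carries partitions over, which the sets \<open>M - P\<close> below require.\<close>

lemma card_partitions_eq_Bell:
  assumes "finite A"
  shows "card {P. partition_on A P} = Bell (card A)"
proof -
  obtain h where h: "bij_betw h A {1..card A}"
    using assms by (metis finite_same_card_bij card_atLeastAtMost diff_Suc_1 finite_atLeastAtMost)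
  define g where "g = inv_into A h"
  have g: "bij_betw g {1..card A} A"
    unfolding g_def by (rule bij_betw_inv_into [OF h])
  \<comment> \<open>Stated for general types, since it is applied to \<open>h\<close> and to
    \<open>g\<close>, which run in opposite directions.\<close>
  have img: "partition_on C ((`) f ` P)" if "bij_betw f B C" "partition_on B P"
    for f :: "'x \<Rightarrow> 'y" and B C P
  proof (rule partition_onI)
    have U: "\<Union>P = B" and inj: "inj_on f B" and C: "f ` B = C"
      using that by (auto simp: partition_on_def bij_betw_def)
    show "\<Union>((`) f ` P) = C" using U C by blast
    show "{} \<notin> (`) f ` P" using that(2) by (auto simp: partition_on_def)
    have "disjoint ((`) f ` P)"
      using that(2) inj U by (intro disjoint_image) (auto simp: partition_on_def)
    then show "disjnt p q" if "p \<in> (`) f ` P" "q \<in> (`) f ` P" "p \<noteq> q" for p q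
      using that by (auto simp: disjoint_def disjnt_def)
  qed
  have inv1: "(`) g ` (`) h ` P = P" if "partition_on A P" for P
  proof -
    have "g ` h ` X = X" if "X \<in> P" for X
    proof -
      have "X \<subseteq> A" using that \<open>partition_on A P\<close> by (auto simp: partition_on_def)
      then show ?thesis
        unfolding g_def using h by (simp add: bij_betw_def inv_into_image_cancel)
    qed
    then show ?thesis by (simp add: image_image)
  qed
  have inv2: "(`) h ` (`) g ` P = P" if "partition_on {1..card A} P" for P
  proof -
    have "h ` g ` X = X" if "X \<in> P" for X
    proof -
      have "X \<subseteq> h ` A" using that \<open>partition_on {1..card A} P\<close> h
        by (auto simp: partition_on_def bij_betw_def)
      then show ?thesis
        unfolding g_def by (simp add: image_inv_into_cancel)
    qed
    then show ?thesis by (simp add: image_image)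
  qed
  have "bij_betw ((`) ((`) h)) {P. partition_on A P} {P. partition_on {1..card A} P}"
    by (rule bij_betw_byWitness [where f' = "(`) ((`) g)"])
      (use inv1 inv2 img [OF h] img [OF g] in auto)
  then show ?thesis
    unfolding Bell_def set_partitions_def by (rule bij_betw_same_card)
qed

text \<open>Distinct elements of \<open>A\<close> lie in distinct blocks, so an element of
  \<open>A\<close> can serve as the name of its block. Such a partition is thus encoded by a triple
  \<open>(P, g, R)\<close>: the elements of \<open>M\<close> whose block meets \<open>A\<close>, the
  names of their blocks, and the blocks that miss \<open>A\<close>.\<close>

lemma card_partitions_separating:
  assumes "finite A" "finite M" "A \<inter> M = {}"
  shows "card {Q. partition_on (A \<union> M) Q \<and> (\<forall>X\<in>Q. \<forall>x\<in>X \<inter> A. \<forall>y\<in>X \<inter> A. x = y)}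
    = (\<Sum>p\<le>card M. (card M choose p) * (card A ^ p * Bell (card M - p)))"
proof -
  define V where "V = {Q. partition_on (A \<union> M) Q \<and> (\<forall>X\<in>Q. \<forall>x\<in>X \<inter> A. \<forall>y\<in>X \<inter> A. x = y)}"
  \<comment> \<open>\<open>D\<close> holds the triples; \<open>glue\<close> assembles a partition
    from a triple, and \<open>cut\<close> reads the triple off again.\<close>
  define D where "D = (SIGMA P:Pow M. (P \<rightarrow>\<^sub>E A) \<times> {R. partition_on (M - P) R})"
  define blk where "blk = (\<lambda>P g x. insert x {y\<in>P. g y = (x :: 'a)})"
  define glue where "glue = (\<lambda>(P, g, R). R \<union> blk P g ` A)"
  define free where "free = (\<lambda>Q. {X\<in>Q. X \<inter> A = {}})"
  define att where "att = (\<lambda>Q. M - \<Union>(free Q))"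
  \<comment> \<open>The element of \<open>A\<close> in the block of \<open>y\<close>. Restricting to
    \<open>att Q\<close> makes \<open>rep Q\<close> extensional, as membership in
    \<open>att Q \<rightarrow>\<^sub>E A\<close> demands.\<close>
  define rep where "rep = (\<lambda>Q. \<lambda>y\<in>att Q. THE x. x \<in> A \<and> (\<exists>X\<in>Q. x \<in> X \<and> y \<in> X))"
  define cut where "cut = (\<lambda>Q. (att Q, rep Q, free Q))"

  have glue_V: "glue (P, g, R) \<in> V" and cut_glue: "cut (glue (P, g, R)) = (P, g, R)"
    if PM: "P \<subseteq> M" and g: "g \<in> P \<rightarrow>\<^sub>E A" and R: "partition_on (M - P) R" for P g R
  proof -
    have UR: "\<Union>R = M - P" and R0: "{} \<notin> R"
      and Rd: "\<And>X Y. X \<in> R \<Longrightarrow> Y \<in> R \<Longrightarrow> X \<noteq> Y \<Longrightarrow> X \<inter> Y = {}"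
      using R by (auto simp: partition_on_def disjoint_def)
    \<comment> \<open>The trace on \<open>A\<close> distinguishes the two kinds of blocks: a
      singleton for \<open>blk P g x\<close>, empty for members of \<open>R\<close>
      (\<open>RA\<close>). This gives the separation property and lets \<open>free\<close> recover
      \<open>R\<close>.\<close>
    have blkA: "blk P g x \<inter> A = {x}" if "x \<in> A" for x
      using that PM assms(3) by (auto simp: blk_def)
    have blkR: "blk P g x \<inter> X = {}" if "x \<in> A" "X \<in> R" for x X
    proof -
      have "X \<subseteq> M - P" using UR that by auto
      then show ?thesis using that PM assms(3) by (auto simp: blk_def)
    qed
    have blkd: "blk P g x \<inter> blk P g y = {}" if "x \<in> A" "y \<in> A" "blk P g x \<noteq> blk P g y" for x y
      using that PM assms(3) by (auto simp: blk_def)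
    have RA: "X \<inter> A = {}" if "X \<in> R" for X
      using that UR assms(3) by blast
    have Ublk: "\<Union>(blk P g ` A) = A \<union> P"
      using g by (auto simp: blk_def)
    have "partition_on (A \<union> M) (R \<union> blk P g ` A)"
    proof (rule partition_onI)
      show "\<Union>(R \<union> blk P g ` A) = A \<union> M"
        using UR Ublk PM by auto
      show "{} \<notin> R \<union> blk P g ` A"
        using R0 by (auto simp: blk_def)
      show "disjnt X Y" if "X \<in> R \<union> blk P g ` A" "Y \<in> R \<union> blk P g ` A" "X \<noteq> Y" for X Y
        using that Rd blkR blkd unfolding disjnt_def by (elim UnE imageE) (simp_all add: Int_commute)
    qed
    moreover have "\<forall>X\<in>R \<union> blk P g ` A. \<forall>x\<in>X \<inter> A. \<forall>y\<in>X \<inter> A. x = y"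
    proof (intro ballI)
      fix X x y assume X: "X \<in> R \<union> blk P g ` A" and xy: "x \<in> X \<inter> A" "y \<in> X \<inter> A"
      then obtain z where "z \<in> A" "X = blk P g z" using RA by blast
      with xy blkA show "x = y" by simp
    qed
    ultimately show "glue (P, g, R) \<in> V"
      by (simp add: glue_def V_def)
    have fr: "free (R \<union> blk P g ` A) = R"
      using RA blkA by (auto simp: free_def)
    have at: "att (R \<union> blk P g ` A) = P"
      using fr UR PM by (auto simp: att_def)
    have "rep (R \<union> blk P g ` A) y = g y" for y
    proof (cases "y \<in> P")
      case True
      have "(THE x. x \<in> A \<and> (\<exists>X\<in>R \<union> blk P g ` A. x \<in> X \<and> y \<in> X)) = g y"
      proof (rule the_equality)
        show "g y \<in> A \<and> (\<exists>X\<in>R \<union> blk P g ` A. g y \<in> X \<and> y \<in> X)"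
        proof -
          have "g y \<in> A" using True g by (rule PiE_mem [rotated])
          moreover have "g y \<in> blk P g (g y)" "y \<in> blk P g (g y)" using True by (simp_all add: blk_def)
          ultimately show ?thesis by blast
        qed
        fix x assume "x \<in> A \<and> (\<exists>X\<in>R \<union> blk P g ` A. x \<in> X \<and> y \<in> X)"
        then obtain X where "x \<in> A" "X \<in> R \<union> blk P g ` A" "x \<in> X" "y \<in> X"
          by blast
        with RA obtain z where "z \<in> A" "X = blk P g z" by blast
        with \<open>x \<in> A\<close> \<open>x \<in> X\<close> blkA have "x = z" by blast
        with \<open>X = blk P g z\<close> \<open>y \<in> X\<close> True PM \<open>z \<in> A\<close> assms(3) show "x = g y"
          by (auto simp: blk_def)
      qed
      then show ?thesis using True at by (simp add: rep_def)
    next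
      case False
      \<comment> \<open>Outside \<open>P\<close> both sides are \<open>undefined\<close>.\<close>
      then show ?thesis using at g by (auto simp: rep_def PiE_def extensional_def)
    qed
    then show "cut (glue (P, g, R)) = (P, g, R)"
      using fr at by (auto simp: glue_def cut_def)
  qed

  have cut_D: "cut Q \<in> D" and glue_cut: "glue (cut Q) = Q" if "Q \<in> V" for Q
  proof -
    have UQ: "\<Union>Q = A \<union> M" and Q0: "{} \<notin> Q"
      and Qd: "\<And>X Y z. X \<in> Q \<Longrightarrow> Y \<in> Q \<Longrightarrow> z \<in> X \<Longrightarrow> z \<in> Y \<Longrightarrow> X = Y"
      and sep: "\<And>X x y. X \<in> Q \<Longrightarrow> x \<in> X \<Longrightarrow> x \<in> A \<Longrightarrow> y \<in> X \<Longrightarrow> y \<in> A \<Longrightarrow> x = y"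
      using that by (auto simp: V_def partition_on_def disjoint_def)
    have frM: "\<Union>(free Q) \<subseteq> M"
      using UQ by (auto simp: free_def)
    \<comment> \<open>Disjointness \<open>Qd\<close> makes the block of \<open>y\<close> unique, and
      \<open>sep\<close> makes its element of \<open>A\<close> unique, so the description is well
      defined.\<close>
    have rep_eq: "rep Q y = x" if "X \<in> Q" "x \<in> X" "x \<in> A" "y \<in> X" "y \<in> M" for X x y
    proof -
      have "y \<in> att Q"
        using that Qd by (auto simp: att_def free_def)
      moreover have "(THE x. x \<in> A \<and> (\<exists>X\<in>Q. x \<in> X \<and> y \<in> X)) = x"
        using that Qd sep by (intro the_equality) blast+
      ultimately show ?thesis by (simp add: rep_def)
    qed
    have att_ex: "\<exists>X\<in>Q. \<exists>x\<in>A. x \<in> X \<and> y \<in> X" if "y \<in> att Q" for y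
    proof -
      have "y \<in> \<Union>Q" using that UQ by (simp add: att_def)
      then obtain X where "X \<in> Q" "y \<in> X" by blast
      moreover from this that have "X \<inter> A \<noteq> {}" unfolding att_def free_def by blast
      ultimately show ?thesis by blast
    qed
    have "rep Q \<in> att Q \<rightarrow>\<^sub>E A"
    proof (rule PiE_I)
      fix y assume y: "y \<in> att Q"
      then obtain X x where "X \<in> Q" "x \<in> A" "x \<in> X" "y \<in> X" using att_ex by blast
      with y rep_eq show "rep Q y \<in> A" by (auto simp: att_def)
    qed (simp add: rep_def)
    moreover have "partition_on (M - att Q) (free Q)"
    proof (rule partition_onI)
      show "\<Union>(free Q) = M - att Q" using frM by (auto simp: att_def)
      show "{} \<notin> free Q" using Q0 by (auto simp: free_def)
      show "disjnt X Y" if "X \<in> free Q" "Y \<in> free Q" "X \<noteq> Y" for X Y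
        using that Qd by (auto simp: free_def disjnt_def)
    qed
    ultimately show "cut Q \<in> D"
      by (auto simp: cut_def D_def att_def)
    \<comment> \<open>An element attached to \<open>x\<close> shares a block with \<open>x\<close>,
      and that block can only be \<open>X\<close>. Conversely, an element of \<open>X\<close> in
      \<open>A\<close> equals \<open>x\<close> by \<open>sep\<close>, and one in \<open>M\<close>
      has representative \<open>x\<close> by \<open>rep_eq\<close>.\<close>
    have blk_eq: "blk (att Q) (rep Q) x = X" if X: "X \<in> Q" "x \<in> X" "x \<in> A" for X x
    proof (intro equalityI subsetI)
      fix y assume "y \<in> blk (att Q) (rep Q) x"
      then consider "y = x" | "y \<in> att Q" "rep Q y = x" by (auto simp: blk_def)
      then show "y \<in> X"
      proof cases
        case 2
        then obtain Y z where "Y \<in> Q" "z \<in> A" "z \<in> Y" "y \<in> Y" using att_ex by blast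
        moreover from this 2 rep_eq have "z = x" by (auto simp: att_def)
        ultimately show ?thesis using X Qd by blast
      qed (use X in simp)
    next
      fix y assume y: "y \<in> X"
      show "y \<in> blk (att Q) (rep Q) x"
      proof (cases "y \<in> A")
        case True
        with y X sep show ?thesis by (auto simp: blk_def)
      next
        case False
        with y X UQ have "y \<in> M" by blast
        moreover have "y \<in> att Q"
          using y X Qd \<open>y \<in> M\<close> by (auto simp: att_def free_def)
        ultimately show ?thesis using rep_eq y X by (auto simp: blk_def)
      qed
    qed
    \<comment> \<open>Together with \<open>free Q\<close>, the blocks missing \<open>A\<close>,
      these make up all of \<open>Q\<close>.\<close>
    have "blk (att Q) (rep Q) ` A = {X\<in>Q. X \<inter> A \<noteq> {}}"
    proof (intro equalityI subsetI)
      fix X assume "X \<in> blk (att Q) (rep Q) ` A"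
      then obtain x where x: "x \<in> A" "X = blk (att Q) (rep Q) x" by blast
      moreover obtain Y where "Y \<in> Q" "x \<in> Y" using x UQ by blast
      ultimately show "X \<in> {X\<in>Q. X \<inter> A \<noteq> {}}" using blk_eq by blast
    next
      fix X assume "X \<in> {X\<in>Q. X \<inter> A \<noteq> {}}"
      then obtain x where "X \<in> Q" "x \<in> X" "x \<in> A" by blast
      then show "X \<in> blk (att Q) (rep Q) ` A" using blk_eq by blast
    qed
    then show "glue (cut Q) = Q"
      by (auto simp: glue_def cut_def free_def)
  qed

  have "bij_betw glue D V"
  proof (rule bij_betw_byWitness [where f' = cut])
    show "\<forall>t\<in>D. cut (glue t) = t" "glue ` D \<subseteq> V"
      using glue_V cut_glue by (auto simp: D_def)
    show "\<forall>Q\<in>V. glue (cut Q) = Q" "cut ` V \<subseteq> D"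
      using cut_D glue_cut by blast+
  qed
  then have "card V = card D"
    by (simp add: bij_betw_same_card)
  also have "\<dots> = (\<Sum>P\<in>Pow M. card ((P \<rightarrow>\<^sub>E A) \<times> {R. partition_on (M - P) R}))"
  proof -
    have "finite ((P \<rightarrow>\<^sub>E A) \<times> {R. partition_on (M - P) R})" if "P \<in> Pow M" for P
      using that assms by (auto intro!: finite_PiE finitely_many_partition_on intro: finite_subset)
    then show ?thesis
      using assms by (simp add: D_def card_SigmaI)
  qed
  also have "\<dots> = (\<Sum>P\<in>Pow M. card A ^ card P * Bell (card M - card P))"
  proof (rule sum.cong)
    fix P assume "P \<in> Pow M"
    then have "finite P" "P \<subseteq> M" using assms by (auto intro: finite_subset)
    then show "card ((P \<rightarrow>\<^sub>E A) \<times> {R. partition_on (M - P) R})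
        = card A ^ card P * Bell (card M - card P)"
      using assms by (simp add: card_cartesian_product card_PiE card_partitions_eq_Bell card_Diff_subset)
  qed simp
  also have "\<dots> = (\<Sum>p\<le>card M. (card M choose p) * (card A ^ p * Bell (card M - p)))"
    using sum_Pow_card [OF assms(2)] .
  finally show ?thesis
    unfolding V_def .
qed

section \<open>Colorings and the count of avoiders\<close>

text \<open>The value \<open>a\<close> is forced on \<open>A\<close> and forbidden elsewhere, so
  only a free map from \<open>S - A\<close> to \<open>C - {a}\<close> remains.\<close>

lemma card_functions_with_fibre:
  assumes "finite S" "finite C" "a \<in> C" "A \<subseteq> S"
  shows "card {f \<in> S \<rightarrow>\<^sub>E C. {x\<in>S. f x = a} = A} = (card C - 1) ^ (card S - card A)"
proof -
  have "bij_betw (\<lambda>f. restrict f (S - A)) {f \<in> S \<rightarrow>\<^sub>E C. {x\<in>S. f x = a} = A} ((S - A) \<rightarrow>\<^sub>E (C - {a}))"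
  proof (rule bij_betw_byWitness [where f' = "\<lambda>g. \<lambda>x\<in>S. if x \<in> A then a else g x"])
    show "\<forall>f\<in>{f \<in> S \<rightarrow>\<^sub>E C. {x\<in>S. f x = a} = A}.
        (\<lambda>x\<in>S. if x \<in> A then a else restrict f (S - A) x) = f"
      by (auto simp: fun_eq_iff PiE_def extensional_def)
    show "\<forall>g\<in>(S - A) \<rightarrow>\<^sub>E (C - {a}). restrict (\<lambda>x\<in>S. if x \<in> A then a else g x) (S - A) = g"
      by (auto simp: fun_eq_iff PiE_def extensional_def)
    show "(\<lambda>f. restrict f (S - A)) ` {f \<in> S \<rightarrow>\<^sub>E C. {x\<in>S. f x = a} = A} \<subseteq> (S - A) \<rightarrow>\<^sub>E (C - {a})"
      by (auto simp: PiE_iff)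
    show "(\<lambda>g. \<lambda>x\<in>S. if x \<in> A then a else g x) ` ((S - A) \<rightarrow>\<^sub>E (C - {a}))
        \<subseteq> {f \<in> S \<rightarrow>\<^sub>E C. {x\<in>S. f x = a} = A}"
      using assms(3,4) by (auto simp: PiE_iff split: if_splits)
  qed
  then have "card {f \<in> S \<rightarrow>\<^sub>E C. {x\<in>S. f x = a} = A} = card ((S - A) \<rightarrow>\<^sub>E (C - {a}))"
    by (rule bij_betw_same_card)
  also have "\<dots> = (card C - 1) ^ (card S - card A)"
    using assms by (simp add: card_PiE card_Diff_subset finite_subset)
  finally show ?thesis .
qed

text \<open>Choose \<open>i + j\<close> elements first, then \<open>j\<close> among them. Writing
  \<open>fact n\<close> as a multiple of the denominator shows that the \<open>div\<close> is
  exact.\<close>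

lemma trinomial_eq_choose_mult:
  assumes "i + j \<le> n"
  shows "trinomial n i j = (n choose (i + j)) * ((i + j) choose j)"
proof -
  have "fact n = fact (i + j) * fact (n - (i + j)) * (n choose (i + j))"
    using binomial_fact_lemma [OF assms] by simp
  also have "fact (i + j) = fact j * fact i * ((i + j) choose j)"
    using binomial_fact_lemma [of j "i + j"] by simp
  finally have "fact n = ((n choose (i + j)) * ((i + j) choose j)) * (fact i * fact j * fact (n - i - j))"
    by (simp add: mult_ac)
  then show ?thesis
    by (simp add: trinomial_def)
qed

text \<open>Once the class \<open>A\<close> of color \<open>a\<close> is fixed, the conditions on
  the partition and on the coloring are independent, and both counts depend only on
  \<open>card A\<close>.\<close>

lemma card_eq_avoiders_11:
  assumes "a \<in> {1..c}"
  shows "card (eq_avoiders_11 n c a) = (\<Sum>k\<le>n. (n choose k) * ((c - 1) ^ (n - k) *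
    (\<Sum>p\<le>n - k. ((n - k) choose p) * (k ^ p * Bell (n - k - p)))))"
proof -
  let ?S = "{1..n}"
  define V where "V = (\<lambda>A. {Q. partition_on ?S Q \<and> (\<forall>X\<in>Q. \<forall>x\<in>X \<inter> A. \<forall>y\<in>X \<inter> A. x = y)})"
  define W where "W = (\<lambda>A. {f \<in> ?S \<rightarrow>\<^sub>E {1..c}. {x\<in>?S. f x = a} = A})"
  have decomp: "eq_avoiders_11 n c a = (\<Union>A\<in>Pow ?S. V A \<times> W A)"
  proof (intro equalityI subsetI)
    fix q assume q: "q \<in> eq_avoiders_11 n c a"
    obtain Q f where [simp]: "q = (Q, f)" by (cases q)
    have "(Q, f) \<in> V {x\<in>?S. f x = a} \<times> W {x\<in>?S. f x = a}"
      using q by (auto simp: eq_avoiders_11_def colored_partitions_def set_partitions_def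
          eq_contains_11_def V_def W_def)
    then show "q \<in> (\<Union>A\<in>Pow ?S. V A \<times> W A)"
      by auto
  next
    fix q assume "q \<in> (\<Union>A\<in>Pow ?S. V A \<times> W A)"
    then obtain A Q f where q: "q = (Q, f)" and Q: "Q \<in> V A" and f: "f \<in> W A" by blast
    have UQ: "\<Union>Q = ?S" using Q by (auto simp: V_def partition_on_def)
    have "\<not> eq_contains_11 a q"
    proof
      assume "eq_contains_11 a q"
      then obtain X x y where "X \<in> Q" "x \<in> X" "y \<in> X" "x \<noteq> y" "f x = a" "f y = a"
        by (auto simp: eq_contains_11_def q)
      moreover from this UQ f have "x \<in> A" "y \<in> A" unfolding W_def by blast+
      ultimately show False using Q by (auto simp: V_def)
    qed
    then show "q \<in> eq_avoiders_11 n c a"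
      using Q f by (auto simp: q eq_avoiders_11_def colored_partitions_def set_partitions_def V_def W_def)
  qed
  have cardV: "card (V A) = (\<Sum>p\<le>n - card A. ((n - card A) choose p) * (card A ^ p * Bell (n - card A - p)))"
    if "A \<subseteq> ?S" for A
  proof -
    have "finite A" using that finite_subset by blast
    then show ?thesis
      using card_partitions_separating [of A "?S - A"] that
      by (simp add: V_def Un_absorb1 card_Diff_subset)
  qed
  have cardW: "card (W A) = (c - 1) ^ (n - card A)" if "A \<subseteq> ?S" for A
    using card_functions_with_fibre [OF _ _ assms that] by (simp add: W_def)
  have fin: "finite (V A \<times> W A)" for A
  proof -
    have "finite (V A)"
      by (rule finite_subset [OF _ finitely_many_partition_on [of ?S]]) (auto simp: V_def)
    moreover have "finite (W A)"
      by (rule finite_subset [OF _ finite_PiE [of ?S "\<lambda>_. {1..c}"]]) (auto simp: W_def)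
    ultimately show ?thesis by simp
  qed
  \<comment> \<open>The union is disjoint because the coloring determines \<open>A\<close>.\<close>
  have "card (eq_avoiders_11 n c a) = (\<Sum>A\<in>Pow ?S. card (V A \<times> W A))"
    unfolding decomp by (rule card_UN_disjoint) (use fin in \<open>auto simp: W_def\<close>)
  also have "\<dots> = (\<Sum>A\<in>Pow ?S. (c - 1) ^ (n - card A) *
      (\<Sum>p\<le>n - card A. ((n - card A) choose p) * (card A ^ p * Bell (n - card A - p))))"
    by (rule sum.cong) (simp_all add: card_cartesian_product cardV cardW)
  also have "\<dots> = (\<Sum>k\<le>n. (n choose k) * ((c - 1) ^ (n - k) *
    (\<Sum>p\<le>n - k. ((n - k) choose p) * (k ^ p * Bell (n - k - p)))))"
    by (subst sum_Pow_card) simp_all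
  finally show ?thesis .
qed

section \<open>Rearrangement into the double sum\<close>

theorem theorem2p1:
  fixes c n a :: nat
  assumes "c \<ge> 1" and "n \<ge> 1" and "a \<in> {1..c}"
  shows "card (eq_avoiders_11 n c a) =
    (\<Sum>(i, j) \<in> {(i, j). i + 2 * j \<le> n}.
       trinomial n i j *
       (\<Sum>p = j..n - i - j.
          ((n - i - j) choose p) * Stirling p j * fact j * Bell (n - i - j - p)
            * (c - 1) ^ (n - i - j)))"
proof -
  define T where "T = (\<lambda>i j. \<Sum>p = j..n - i - j.
          ((n - i - j) choose p) * Stirling p j * fact j * Bell (n - i - j - p)
            * (c - 1) ^ (n - i - j))"
  \<comment> \<open>For a fixed size \<open>k\<close> of the color class, \<open>k ^ p\<close> is
    expanded and the sums over \<open>p\<close> and \<open>j\<close> are swapped; \<open>i\<close>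
    appears as \<open>k - j\<close>.\<close>
  have inner: "(n choose k) * ((c - 1) ^ (n - k) *
      (\<Sum>p\<le>n - k. ((n - k) choose p) * (k ^ p * Bell (n - k - p))))
    = (\<Sum>j\<le>k. trinomial n (k - j) j * T (k - j) j)" if "k \<le> n" for k
  proof -
    have "(n choose k) * ((c - 1) ^ (n - k) *
        (\<Sum>p\<le>n - k. ((n - k) choose p) * (k ^ p * Bell (n - k - p))))
      = (\<Sum>p\<le>n - k. \<Sum>j\<le>k. (n choose k) * (k choose j) *
          (((n - k) choose p) * Stirling p j * fact j * Bell (n - k - p) * (c - 1) ^ (n - k)))"
      by (simp only: power_eq_sum_Stirling [of k] sum_distrib_left sum_distrib_right mult_ac)
    also have "\<dots> = (\<Sum>j\<le>k. \<Sum>p\<le>n - k. (n choose k) * (k choose j) *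
          (((n - k) choose p) * Stirling p j * fact j * Bell (n - k - p) * (c - 1) ^ (n - k)))"
      by (rule sum.swap)
    also have "\<dots> = (\<Sum>j\<le>k. trinomial n (k - j) j * T (k - j) j)"
    proof (rule sum.cong)
      fix j assume "j \<in> {..k}"
      then have j: "j \<le> k" by simp
      have "T (k - j) j = (\<Sum>p = j..n - k.
          ((n - k) choose p) * Stirling p j * fact j * Bell (n - k - p) * (c - 1) ^ (n - k))"
        using j by (simp add: T_def)
      \<comment> \<open>\<open>Stirling p j\<close> is 0 for \<open>p < j\<close>.\<close>
      also have "\<dots> = (\<Sum>p\<le>n - k.
          ((n - k) choose p) * Stirling p j * fact j * Bell (n - k - p) * (c - 1) ^ (n - k))"
        by (rule sum.mono_neutral_left) auto
      finally show "(\<Sum>p\<le>n - k. (n choose k) * (k choose j) *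
          (((n - k) choose p) * Stirling p j * fact j * Bell (n - k - p) * (c - 1) ^ (n - k)))
        = trinomial n (k - j) j * T (k - j) j"
        using j that by (simp add: trinomial_eq_choose_mult sum_distrib_left)
    qed simp
    finally show ?thesis .
  qed
  have "card (eq_avoiders_11 n c a) = (\<Sum>k\<le>n. \<Sum>j\<le>k. trinomial n (k - j) j * T (k - j) j)"
    unfolding card_eq_avoiders_11 [OF assms(3)] by (rule sum.cong) (simp_all only: inner atMost_iff)
  also have "\<dots> = (\<Sum>(k, j) \<in> (SIGMA k:{..n}. {..k}). trinomial n (k - j) j * T (k - j) j)"
    by (rule sum.Sigma) auto
  \<comment> \<open>Substitution \<open>k = i + j\<close>.\<close>
  also have "\<dots> = (\<Sum>(i, j) \<in> {(i, j). i + j \<le> n}. trinomial n i j * T i j)"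
    by (rule sum.reindex_bij_witness [where i = "\<lambda>(i, j). (i + j, j)" and j = "\<lambda>(k, j). (k - j, j)"])
      auto
  \<comment> \<open>If \<open>i + 2 * j > n\<close>, then \<open>n - i - j < j\<close> and the range
    of \<open>p\<close> in \<open>T i j\<close> is empty: \<open>j\<close> elements of
    \<open>A\<close> cannot all receive something from fewer than \<open>j\<close> others.\<close>
  also have "\<dots> = (\<Sum>(i, j) \<in> {(i, j). i + 2 * j \<le> n}. trinomial n i j * T i j)"
  proof (rule sum.mono_neutral_right)
    show "finite {(i, j). i + j \<le> n}"
      by (rule finite_subset [of _ "{..n} \<times> {..n}"]) auto
    have "T i j = 0" if "i + j \<le> n" "\<not> i + 2 * j \<le> n" for i j
    proof -
      have "{j..n - i - j} = {}" using that by auto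
      then show ?thesis by (simp only: T_def sum.empty)
    qed
    then show "\<forall>q\<in>{(i, j). i + j \<le> n} - {(i, j). i + 2 * j \<le> n}.
        (case q of (i, j) \<Rightarrow> trinomial n i j * T i j) = 0"
      by (simp add: split_beta)
  qed auto
  finally show ?thesis
    unfolding T_def .
qed

end
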